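(* Let $\{t(n)\}_{n=1}^\infty$ be a sequence of integers with $t(n)\ge 2$ for all $n$, let $\mathcal{B}_1=\{0,11\}$, and let $\mathcal{B}_n$, $\tau(n)$, $s(n)$, $l(n)$, $X_n$ ($n\in\mathbb{N}$) be constructed from these parameters as described in the context. Assume that for every $n\in\mathbb{N}$: (1) $t(n)>\frac{|\tau(n)|}{2l(n)-3s(n)}$; (2) $t(n)\ge\frac{l(n)}{l(n)-s(n)}$; (3) $t(n)\ge\frac{2s(n)+2l(n)+3|\tau(n)|}{l(n)}$; (4) $t(n)>\frac{3l(n)+|\tau(n)|}{s(n)2^{-n}}$. Then the shift space $X=\bigcap_{n=1}^\infty X_n$ is $\bar d$-complete.
   Context: $\mathbb{N}=\{1,2,\ldots\}$. Let $\mathscr{A}=\{0,1\}$ and let $\mathscr{A}^\infty$ be the set of sequences $x=\{x_n\}_{n=0}^\infty$ over $\mathscr{A}$, with shift map $\sigma(x)=\{x_{n+1}\}_{n=0}^\infty$. For a finite word $w$ over $\mathscr{A}$, $|w|$ denotes its length. Construction. Given the finite nonempty set of words $\mathcal{B}_n$, let $k(n)$ be its cardinality, enumerate its elements as $\beta^{(n)}_1,\ldots,\beta^{(n)}_{k(n)}$, and let $\tau(n)=\beta^{(n)}_1\ldots\beta^{(n)}_{k(n)}$ be their concatenation. Let $s(n)$ (resp. $l(n)$) be the length of the shortest (resp. longest) word in $\mathcal{B}_n$. Put $$\mathcal{B}_{n+1}=\{b_1b_2\ldots b_{t(n)}\tau(n): b_i\in\mathcal{B}_n\text{ for all }1\le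 i\le t(n)\}.$$ $X_n\subseteq\mathscr{A}^\infty$ is the set of all infinite concatenations of words from $\mathcal{B}_n$ together with all their shifts (images under $\sigma^k$, $k\ge0$). For $x,y\in\mathscr{A}^\infty$ let $\bar d(x,y)=\limsup_{n\to\infty}\frac1n|\{i\in[0,n): x_i\ne y_i\}|$ (a pseudometric). A set $X\subseteq\mathscr{A}^\infty$ is $\bar d$-complete if for every sequence $\{z^{(n)}\}_{n=1}^\infty\subset X$ that is Cauchy for $\bar d$ there is $z\in X$ with $\lim_{n\to\infty}\bar d(z^{(n)},z)=0$. *)

theory Defs
  imports "HOL-Analysis.Analysis" "HOL-Library.Z2"
begin

text \<open>The alphabet is the two-element type \<^typ>\<open>bit\<close>; \<^typ>\<open>nat \<Rightarrow> bit\<close> is the full one-sided shift.\<close>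

definition shift :: "(nat \<Rightarrow> bit) \<Rightarrow> (nat \<Rightarrow> bit)" where
  "shift x = (\<lambda>n. x (Suc n))"

text \<open>\<open>infinite_concat w x\<close>: the sequence \<open>x\<close> is \<open>w 0 @ w 1 @ w 2 @ \<dots>\<close>, i.e. \<open>w k\<close> is
  read in \<open>x\<close> from position \<open>|w 0| + \<dots> + |w (k - 1)|\<close> on.  This determines \<open>x\<close> as soon as
  all the words \<open>w k\<close> are nonempty, which is the case for the block sets below.\<close>

definition infinite_concat :: "(nat \<Rightarrow> bit list) \<Rightarrow> (nat \<Rightarrow> bit) \<Rightarrow> bool" where
  "infinite_concat w x \<longleftrightarrow>
     (\<forall>k j. j < length (w k) \<longrightarrow> x ((\<Sum>i<k. length (w i)) + j) = w k ! j)"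

definition concat_shift :: "bit list set \<Rightarrow> (nat \<Rightarrow> bit) set" where
  "concat_shift B = {(shift ^^ k) x | k w x. (\<forall>i. w i \<in> B) \<and> infinite_concat w x}"

definition shortest :: "bit list set \<Rightarrow> nat" where
  "shortest B = Min (length ` B)"

definition longest :: "bit list set \<Rightarrow> nat" where
  "longest B = Max (length ` B)"

text \<open>Stages are indexed from \<open>1\<close>; index \<open>0\<close> is unused.  The list \<open>\<beta> n\<close> is an arbitrary
  enumeration without repetition of \<open>B n\<close>, and its concatenation is the word \<open>\<tau>(n)\<close>.\<close>

definition block_construction ::
  "(nat \<Rightarrow> nat) \<Rightarrow> (nat \<Rightarrow> bit list set) \<Rightarrow> (nat \<Rightarrow> bit list list) \<Rightarrow> bool" where
  "block_construction t B \<beta> \<longleftrightarrow>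
     (\<forall>n\<ge>1. distinct (\<beta> n) \<and> set (\<beta> n) = B n) \<and>
     (\<forall>n\<ge>1. B (Suc n) =
        {concat bs @ concat (\<beta> n) | bs. length bs = t n \<and> set bs \<subseteq> B n})"

definition dbar :: "(nat \<Rightarrow> bit) \<Rightarrow> (nat \<Rightarrow> bit) \<Rightarrow> real" where
  "dbar x y = real_of_ereal
     (limsup (\<lambda>n. ereal (real (card {i. i < n \<and> x i \<noteq> y i}) / real n)))"

text \<open>The coercion from extended reals loses nothing.\<close>

lemma ereal_dbar:
  "ereal (dbar x y) = limsup (\<lambda>n. ereal (real (card {i. i < n \<and> x i \<noteq> y i}) / real n))"
proof -
  let ?f = "\<lambda>n. ereal (real (card {i. i < n \<and> x i \<noteq> y i}) / real n)"
  have "card {i. i < n \<and> x i \<noteq> y i} \<le> n" for n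
    using card_mono[of "{..<n}" "{i. i < n \<and> x i \<noteq> y i}"] by auto
  then have "?f n \<le> 1" for n
    by (simp add: divide_le_eq_1 neq0_conv[symmetric] del: neq0_conv)
  then have "limsup ?f \<le> 1"
    by (intro Limsup_bounded always_eventually) auto
  moreover have "0 \<le> limsup ?f"
    by (intro le_Limsup always_eventually) auto
  ultimately have "\<bar>limsup ?f\<bar> \<noteq> \<infinity>"
    by auto
  then show ?thesis
    by (simp add: dbar_def ereal_real')
qed

definition dbar_Cauchy :: "(nat \<Rightarrow> nat \<Rightarrow> bit) \<Rightarrow> bool" where
  "dbar_Cauchy z \<longleftrightarrow> (\<forall>e>0. \<exists>N. \<forall>m\<ge>N. \<forall>n\<ge>N. dbar (z m) (z n) < e)"

definition dbar_complete :: "(nat \<Rightarrow> bit) set \<Rightarrow> bool" where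
  "dbar_complete X \<longleftrightarrow>
     (\<forall>z. range z \<subseteq> X \<and> dbar_Cauchy z \<longrightarrow> (\<exists>y\<in>X. (\<lambda>n. dbar (z n) y) \<longlonglongrightarrow> 0))"

end

theory Submission
  imports Defs "HOL-Library.Omega_Words_Fun"
begin

text \<open>
  Since \<open>3 s(n) < 2 l(n)\<close> at every level and every length in \<open>{s(n)..l(n)}\<close> occurs in \<open>B\<^sub>n\<close>,
  every gap of length at least \<open>2 s(n)\<close> can be filled with words of \<open>B\<^sub>n\<close>.  This has two
  consequences.  First, at a fixed level \<open>n\<close> a concatenation of words from \<open>B\<^sub>n\<close> can be switched to
  any given point of \<open>X\<^sub>n\<close> at the cost of boundedly many symbols.  Second, a
  concatenation of words from \<open>B\<^sub>n\<close> can be turned into one of words from \<open>B\<^sub>n\<^sub>+\<^sub>1\<close> by inserting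
  \<open>\<tau>(n)\<close> after every \<open>t(n)\<close> words and realigning just afterwards; by condition (4) this changes
  at most \<open>2\<^sup>-\<^sup>n k\<close> of the first \<open>k\<close> symbols, for \<^emph>\<open>every\<close> \<open>k\<close>.

  Given a Cauchy sequence \<open>z\<close>, alternate the two operations: switch from the current sequence to
  the next \<open>z\<^sub>m\<close> at a very late position \<open>N\<^sub>m\<close>, then pass to the next level.  The errors being
  summable and uniform in \<open>k\<close>, the sequences obtained converge pointwise, and the limit is the
  point sought.
\<close>

section \<open>Infinite concatenations of words\<close>

\<comment> \<open>Coinduction avoids positions and partial sums: a new sequence is handled by
  peeling off one word at a time. No shift is involved; the sequence starts at a word
  boundary.\<close>
coinductive_set concats :: "'a list set \<Rightarrow> 'a word set" for B where
  conc: "b \<in> B \<Longrightarrow> x \<in> concats B \<Longrightarrow> b \<frown> x \<in> concats B"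

lemma concats_obtain:
  assumes "x \<in> concats B"
  obtains b x' where "b \<in> B" "x' \<in> concats B" "x = b \<frown> x'"
  using assms by cases blast

lemma concats_obtain_list:
  assumes "x \<in> concats B"
  obtains ws x' where "length ws = k" "set ws \<subseteq> B" "x' \<in> concats B" "x = concat ws \<frown> x'"
  using assms
proof (induction k arbitrary: x thesis)
  case 0
  from 0(1)[of "[]" x] show ?case using 0(2) by simp
next
  case (Suc k)
  obtain b y where b: "b \<in> B" "y \<in> concats B" "x = b \<frown> y"
    using Suc.prems(2) by (rule concats_obtain)
  from Suc.IH[OF _ b(2)] obtain ws x' where
    w: "length ws = k" "set ws \<subseteq> B" "x' \<in> concats B" "y = concat ws \<frown> x'" by blast
  show ?case
    by (rule Suc.prems(1)[of "b # ws" x']) (use b w in auto)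
qed

lemma concats_appendI:
  assumes "set ws \<subseteq> B" "x \<in> concats B"
  shows "concat ws \<frown> x \<in> concats B"
  using assms
proof (induction ws)
  case (Cons a ws)
  then have "concat ws \<frown> x \<in> concats B" "a \<in> B" by auto
  then have "a \<frown> (concat ws \<frown> x) \<in> concats B" by (rule concats.conc[rotated])
  then show ?case by simp
qed simp

text \<open>Coinduction with a buffer: \<open>bs\<close> holds the words of \<open>B\<close> still
  to be read out before the unsplit tail \<open>x'\<close>. As \<open>ref\<close> supplies nonempty
  lists, an empty buffer can be refilled.\<close>

lemma concats_refine:
  assumes ref: "\<And>b. b \<in> B' \<Longrightarrow> \<exists>bs. bs \<noteq> [] \<and> set bs \<subseteq> B \<and> b = concat bs"
  shows "concats B' \<subseteq> concats B"
proof
  fix x assume "x \<in> concats B'"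
  then have "\<exists>bs x'. set bs \<subseteq> B \<and> x' \<in> concats B' \<and> x = concat bs \<frown> x'"
    by (intro exI[of _ "[]"]) auto
  then show "x \<in> concats B"
  proof (rule concats.coinduct[where X = "\<lambda>x. \<exists>bs x'. set bs \<subseteq> B \<and> x' \<in> concats B' \<and> x = concat bs \<frown> x'"])
    fix x assume "\<exists>bs x'. set bs \<subseteq> B \<and> x' \<in> concats B' \<and> x = concat bs \<frown> x'"
    then obtain bs x' where bs: "set bs \<subseteq> B" "x' \<in> concats B'" "x = concat bs \<frown> x'" by blast
    obtain cs y where cs: "cs \<noteq> []" "set cs \<subseteq> B" "y \<in> concats B'" "x = concat cs \<frown> y"
    proof (cases "bs = []")
      case True
      from bs(2) obtain b y where b: "b \<in> B'" "y \<in> concats B'" "x' = b \<frown> y"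
        by (rule concats_obtain)
      with ref[OF b(1)] True bs that show ?thesis by auto
    qed (use bs that in auto)
    then obtain c cs' where c: "cs = c # cs'" by (cases cs) auto
    show "\<exists>b x'. x = b \<frown> x' \<and> b \<in> B \<and>
        ((\<exists>bs y. set bs \<subseteq> B \<and> y \<in> concats B' \<and> x' = concat bs \<frown> y) \<or> x' \<in> concats B)"
      by (rule exI[of _ c], rule exI[of _ "concat cs' \<frown> y"]) (use c cs in auto)
  qed
qed

text \<open>Compactness: as \<open>B\<close> is finite, one first word serves approximations of
  every length, and the argument repeats on the tail.\<close>

lemma concats_closed:
  assumes fin: "finite B" and lim: "\<And>n. \<exists>x\<in>concats B. \<forall>i<n. x i = y i"
  shows "y \<in> concats B"
proof -
  have "\<forall>n. \<exists>x\<in>concats B. \<forall>i<n. x i = y i" using lim by blast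
  then show ?thesis
  proof (rule concats.coinduct[where X = "\<lambda>y. \<forall>n. \<exists>x\<in>concats B. \<forall>i<n. x i = y i"])
    fix y assume near: "\<forall>n. \<exists>x\<in>concats B. \<forall>i<n. x i = y i"
    have "\<exists>b\<in>B. \<forall>n. \<exists>x'\<in>concats B. \<forall>i<n. (b \<frown> x') i = y i"
    proof (rule ccontr)
      assume "\<not> ?thesis"
      then have "\<forall>b\<in>B. \<exists>n. \<forall>x'\<in>concats B. \<exists>i<n. (b \<frown> x') i \<noteq> y i" by simp
      \<comment> \<open>\<open>f b\<close> is a prefix length at which \<open>b\<close> fails as
        first word; an approximation up to the maximum of these contradicts the failure of its own
        first word.\<close>
      from bchoice[OF this] obtain f
        where f: "\<forall>b\<in>B. \<forall>x'\<in>concats B. \<exists>i<f b. (b \<frown> x') i \<noteq> y i" ..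
      obtain x where x: "x \<in> concats B" "\<forall>i<Max (f ` B). x i = y i" using near by blast
      from x(1) obtain b x' where b: "b \<in> B" "x' \<in> concats B" "x = b \<frown> x'"
        by (rule concats_obtain)
      with f[rule_format, OF b(1,2)] obtain i where "i < f b" "x i \<noteq> y i" by auto
      moreover have "f b \<le> Max (f ` B)" using fin b by simp
      ultimately show False using x(2) by auto
    qed
    then obtain b where b: "b \<in> B"
      and bl: "\<And>n. \<exists>x'\<in>concats B. \<forall>i<n. (b \<frown> x') i = y i" by auto
    have "y = b \<frown> suffix (length b) y"
    proof
      fix i
      have "b ! i = y i" if "i < length b" using bl[of "length b"] that by auto
      then show "y i = (b \<frown> suffix (length b) y) i" by (cases "i < length b") auto
    qed
    moreover have "\<forall>n. \<exists>x\<in>concats B. \<forall>i<n. x i = suffix (length b) y i"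
    proof
      fix n
      obtain x' where "x' \<in> concats B" "\<forall>i<length b + n. (b \<frown> x') i = y i"
        using bl[of "length b + n"] by auto
      moreover have "x' i = suffix (length b) y i" if "i < n" for i
        using calculation(2)[rule_format, of "length b + i"] that by simp
      ultimately show "\<exists>x\<in>concats B. \<forall>i<n. x i = suffix (length b) y i" by blast
    qed
    ultimately show "\<exists>b x. y = b \<frown> x \<and> b \<in> B \<and>
        ((\<forall>n. \<exists>x'\<in>concats B. \<forall>i<n. x' i = x i) \<or> x \<in> concats B)"
      using b by (intro exI conjI disjI1)
  qed
qed

section \<open>Agreement with concatenation by explicit positions\<close>

lemma infinite_concat_exists:
  assumes ne: "\<And>k. w k \<noteq> []"
  shows "\<exists>x. infinite_concat w x"
proof -
  define S where "S k = (\<Sum>i<k. length (w i))" for k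
  have S_Suc: "S (Suc k) = S k + length (w k)" for k by (simp add: S_def)
  have mono: "S a \<le> S b" if "a \<le> b" for a b
    unfolding S_def using that by (intro sum_mono2) auto
  define x where "x i = (let k = LEAST k. i < S (Suc k) in w k ! (i - S k))" for i
  have "x (S k + j) = w k ! j" if "j < length (w k)" for k j
  proof -
    have "(LEAST k'. S k + j < S (Suc k')) = k"
    proof (rule Least_equality)
      show "S k + j < S (Suc k)" using that by (simp add: S_Suc)
    next
      fix k' assume "S k + j < S (Suc k')"
      then show "k \<le> k'" using mono[of "Suc k'" k] by (cases "k \<le> k'") auto
    qed
    then show ?thesis by (simp add: x_def)
  qed
  then show ?thesis by (auto simp: infinite_concat_def S_def)
qed

lemma infinite_concat_Suc:
  assumes "infinite_concat w x"
  shows "x = w 0 \<frown> suffix (length (w 0)) x"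
    and "infinite_concat (\<lambda>i. w (Suc i)) (suffix (length (w 0)) x)"
proof -
  show "x = w 0 \<frown> suffix (length (w 0)) x"
  proof
    fix i
    have "x i = w 0 ! i" if "i < length (w 0)"
      using assms[unfolded infinite_concat_def, rule_format, of i 0] that by simp
    then show "x i = (w 0 \<frown> suffix (length (w 0)) x) i" by (cases "i < length (w 0)") auto
  qed
  have "x (length (w 0) + ((\<Sum>i<k. length (w (Suc i))) + j)) = w (Suc k) ! j"
    if "j < length (w (Suc k))" for k j
  proof -
    have "x ((\<Sum>i<Suc k. length (w i)) + j) = w (Suc k) ! j"
      using assms that unfolding infinite_concat_def by blast
    then show ?thesis
      by (simp only: sum.lessThan_Suc_shift add.assoc)
  qed
  then show "infinite_concat (\<lambda>i. w (Suc i)) (suffix (length (w 0)) x)"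
    by (auto simp: infinite_concat_def)
qed

lemma infinite_concat_in_concats:
  assumes "\<And>i. w i \<in> B" "infinite_concat w x"
  shows "x \<in> concats B"
proof -
  have "\<exists>w. (\<forall>i. w i \<in> B) \<and> infinite_concat w x" using assms by blast
  then show ?thesis
  proof (rule concats.coinduct[where X = "\<lambda>x. \<exists>w. (\<forall>i. w i \<in> B) \<and> infinite_concat w x"])
    fix x assume "\<exists>w. (\<forall>i. w i \<in> B) \<and> infinite_concat w x"
    then obtain w where w: "\<forall>i. w i \<in> B" "infinite_concat w x" by blast
    show "\<exists>b y. x = b \<frown> y \<and> b \<in> B \<and>
        ((\<exists>w. (\<forall>i. w i \<in> B) \<and> infinite_concat w y) \<or> y \<in> concats B)"
    proof (intro exI conjI)
      show "x = w 0 \<frown> suffix (length (w 0)) x" by (rule infinite_concat_Suc[OF w(2)])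
      show "w 0 \<in> B" using w(1) by blast
      show "(\<exists>w'. (\<forall>i. w' i \<in> B) \<and> infinite_concat w' (suffix (length (w 0)) x))
          \<or> suffix (length (w 0)) x \<in> concats B"
        using infinite_concat_Suc(2)[OF w(2)] w(1)
        by (intro disjI1 exI[of _ "\<lambda>i. w (Suc i)"] conjI) auto
    qed
  qed
qed

lemma concats_infinite_concat:
  assumes "x \<in> concats B"
  obtains w where "\<And>i. w i \<in> B" "infinite_concat w x"
proof -
  \<comment> \<open>One unfolding of \<open>concats\<close>; dependent choice yields the words
    \<open>w k\<close> and the tails \<open>y k\<close> left after \<open>k\<close> words.\<close>
  define R where "R b y y' \<longleftrightarrow> b \<in> B \<and> y' \<in> concats B \<and> y = b \<frown> y'" for b and y y' :: "nat \<Rightarrow> bit"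
  have "\<exists>y. \<forall>n. (y n \<in> concats B \<and> (n = 0 \<longrightarrow> y n = x)) \<and> (\<exists>b. R b (y n) (y (Suc n)))"
  proof (rule dependent_nat_choice)
    fix y n assume "y \<in> concats B \<and> (n = (0::nat) \<longrightarrow> y = x)"
    then show "\<exists>y'. (y' \<in> concats B \<and> (Suc n = 0 \<longrightarrow> y' = x)) \<and> (\<exists>b. R b y y')"
      unfolding R_def by (metis concats_obtain old.nat.distinct(2))
  qed (use assms in blast)
  then obtain y w where y: "y 0 = x" "\<And>n. R (w n) (y n) (y (Suc n))" by metis
  have suf: "suffix (\<Sum>i<k. length (w i)) x = y k" for k
  proof (induction k)
    case (Suc k)
    have "suffix (\<Sum>i<Suc k. length (w i)) x = suffix (length (w k)) (y k)"
      by (simp only: Suc[symmetric] suffix_suffix sum.lessThan_Suc)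
    also have "\<dots> = y (Suc k)" using y(2)[of k] by (simp add: R_def)
    finally show ?case .
  qed (simp add: y)
  have "infinite_concat w x"
    unfolding infinite_concat_def
  proof (intro allI impI)
    fix k j assume j: "j < length (w k)"
    have "x ((\<Sum>i<k. length (w i)) + j) = y k j" by (simp only: suf[symmetric] suffix_nth)
    also have "\<dots> = w k ! j" using y(2)[of k] j by (simp add: R_def)
    finally show "x ((\<Sum>i<k. length (w i)) + j) = w k ! j" .
  qed
  moreover have "w i \<in> B" for i using y(2)[of i] by (simp add: R_def)
  ultimately show thesis using that by blast
qed

section \<open>Word boundaries in every window of given length\<close>

lemma concats_boundary_list:
  assumes x: "x \<in> concats B" and len: "\<And>b. b \<in> B \<Longrightarrow> 0 < length b \<and> length b \<le> L"
  obtains ws y where "set ws \<subseteq> B" "y \<in> concats B" "x = concat ws \<frown> y"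
    "N \<le> length (concat ws)" "length (concat ws) < N + L"
proof -
  have "\<exists>ws y. set ws \<subseteq> B \<and> y \<in> concats B \<and> x = concat ws \<frown> y \<and>
     N \<le> length (concat ws) \<and> length (concat ws) < N + L"
  proof (induction N)
    case 0
    obtain b where "b \<in> B" using x by (rule concats_obtain)
    with len[of b] have "0 < L" by linarith
    with x show ?case by (intro exI[of _ "[]"] exI[of _ x]) simp
  next
    case (Suc N)
    then obtain ws y where ws: "set ws \<subseteq> B" "y \<in> concats B" "x = concat ws \<frown> y"
      "N \<le> length (concat ws)" "length (concat ws) < N + L" by blast
    \<comment> \<open>When the window moves one place to the right, the boundary can only drop out
      at its left end \<open>N\<close>; one more word, of length between 1 and \<open>L\<close>,
      lands inside again.\<close>
    show ?case
    proof (cases "N = length (concat ws)")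
      case True
      obtain b y' where b: "b \<in> B" "y' \<in> concats B" "y = b \<frown> y'"
        using ws(2) by (rule concats_obtain)
      show ?thesis
      proof (intro exI conjI)
        show "set (ws @ [b]) \<subseteq> B" using ws(1) b(1) by simp
        show "y' \<in> concats B" by fact
        show "x = concat (ws @ [b]) \<frown> y'" using ws(3) b(3) by simp
      qed (use True len[OF b(1)] in \<open>simp_all add: Suc_le_eq\<close>)
    next
      case False
      then have "Suc N \<le> length (concat ws)" "length (concat ws) < Suc N + L"
        using ws(4,5) by linarith+
      then show ?thesis using ws(1-3) by blast
    qed
  qed
  then show thesis using that by blast
qed

lemma concats_boundary:
  assumes x: "x \<in> concats B" and len: "\<And>b. b \<in> B \<Longrightarrow> 0 < length b \<and> length b \<le> L"
  obtains j where "N \<le> j" "j < N + L" "suffix j x \<in> concats B"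
proof -
  obtain ws y where ws: "y \<in> concats B" "x = concat ws \<frown> y"
    "N \<le> length (concat ws)" "length (concat ws) < N + L"
    using concats_boundary_list[OF x len] by metis
  have "suffix (length (concat ws)) x = y" by (simp only: ws(2) suffix_conc_length)
  with ws(1,3,4) show thesis by (intro that[of "length (concat ws)"]) simp_all
qed

lemma shift_funpow: "(shift ^^ k) x = suffix k x"
  by (induction k) (auto simp: shift_def fun_eq_iff)

lemma concats_subset_concat_shift: "concats B \<subseteq> concat_shift B"
proof
  fix x assume "x \<in> concats B"
  then obtain w where "\<And>i. w i \<in> B" "infinite_concat w x"
    using concats_infinite_concat by blast
  then show "x \<in> concat_shift B"
    unfolding concat_shift_def by (intro CollectI exI[of _ 0] exI[of _ w] exI[of _ x]) auto
qed

lemma concat_shift_boundary: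
  assumes x: "x \<in> concat_shift B" and len: "\<And>b. b \<in> B \<Longrightarrow> 0 < length b \<and> length b \<le> L"
  obtains j where "N \<le> j" "j < N + L" "suffix j x \<in> concats B"
proof -
  from x obtain k w y where y: "x = suffix k y" "\<forall>i. w i \<in> B" "infinite_concat w y"
    unfolding concat_shift_def by (auto simp: shift_funpow)
  then have "y \<in> concats B" by (auto intro: infinite_concat_in_concats)
  from concats_boundary[OF this len, of "k + N"] obtain j
    where j: "k + N \<le> j" "j < k + N + L" "suffix j y \<in> concats B" by blast
  show thesis
    by (rule that[of "j - k"]) (use j y in auto)
qed

section \<open>Words with a prescribed total length\<close>

lemma sum_of_lengths:
  assumes B: "length ` B = {a..b}" and k: "r * a \<le> k" "k \<le> r * b"
  obtains bs where "length bs = r" "set bs \<subseteq> B" "length (concat bs) = k"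
proof -
  have ab: "k \<le> r * b \<Longrightarrow> r * a \<le> k \<Longrightarrow>
     \<exists>bs. length bs = r \<and> set bs \<subseteq> B \<and> length (concat bs) = k" for k
  proof (induction r arbitrary: k)
    case (Suc r)
    have "Suc r * a \<le> Suc r * b" using le_trans[OF Suc.prems(2) Suc.prems(1)] .
    then have "a \<le> b" by (simp only: Suc_mult_le_cancel1)
    \<comment> \<open>The least first length whose remainder \<open>r\<close> further words can
      still cover; by truncated subtraction it is \<open>a\<close> whenever
      \<open>k \<le> r * b\<close>.\<close>
    define j where "j = max a (k - r * b)"
    have j: "a \<le> j" "j \<le> b" using Suc.prems \<open>a \<le> b\<close> by (auto simp: j_def)
    have "r * a \<le> r * b" using \<open>a \<le> b\<close> by simp
    then have kj: "r * a \<le> k - j" "k - j \<le> r * b" "j \<le> k" 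
      using Suc.prems[unfolded mult_Suc] \<open>a \<le> b\<close> unfolding j_def by arith+
    from j B obtain c where c: "c \<in> B" "length c = j"
      by (metis atLeastAtMost_iff imageE)
    from Suc.IH[OF kj(2,1)] obtain bs
      where "length bs = r" "set bs \<subseteq> B" "length (concat bs) = k - j" by blast
    with c kj show ?case by (intro exI[of _ "c # bs"]) auto
  qed simp
  from ab[OF k(2,1)] show thesis using that by blast
qed

text \<open>Since \<open>3 a < 2 b\<close>, the intervals \<open>{2 a..2 b}\<close> and \<open>{3 a..3 b}\<close> leave no gap.\<close>
lemma fill_gap:
  assumes B: "length ` B = {a..b}" and ab: "3 * a < 2 * b" and L: "2 * a \<le> L" "L \<le> 2 * a + b"
  obtains cs where "length cs \<le> 3" "set cs \<subseteq> B" "length (concat cs) = L"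
proof (cases "L \<le> 2 * b")
  case True
  obtain bs where "length bs = 2" "set bs \<subseteq> B" "length (concat bs) = L"
    using sum_of_lengths[OF B L(1) True] .
  then show thesis by (intro that[of bs]) auto
next
  case False
  then have "3 * a \<le> L" "L \<le> 3 * b" using ab L by linarith+
  then obtain bs where "length bs = 3" "set bs \<subseteq> B" "length (concat bs) = L"
    using sum_of_lengths[OF B] by blast
  then show thesis by (intro that[of bs]) auto
qed

section \<open>Mismatch counts and the pseudometric\<close>

definition hamming :: "nat \<Rightarrow> 'a word \<Rightarrow> 'a word \<Rightarrow> nat" where
  "hamming n x y = card {i. i < n \<and> x i \<noteq> y i}"

definition switch_at :: "nat \<Rightarrow> 'a word \<Rightarrow> 'a word \<Rightarrow> 'a word" where
  "switch_at N x y = (\<lambda>i. if i < N then x i else y i)"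

lemma hamming_cong:
  assumes "\<And>i. i < n \<Longrightarrow> x i = x' i" "\<And>i. i < n \<Longrightarrow> y i = y' i"
  shows "hamming n x y = hamming n x' y'"
  unfolding hamming_def using assms by (intro arg_cong[of _ _ card]) auto

lemma hamming_le: "hamming n x y \<le> n"
  using card_mono[of "{..<n}" "{i. i < n \<and> x i \<noteq> y i}"] by (auto simp: hamming_def)

lemma hamming_eq_0: "hamming n x y = 0 \<longleftrightarrow> (\<forall>i<n. x i = y i)"
  by (auto simp: hamming_def)

lemma hamming_commute: "hamming n x y = hamming n y x"
  by (simp add: hamming_def eq_commute)

lemma hamming_triangle: "hamming n x z \<le> hamming n x y + hamming n y z"
proof -
  have "hamming n x z \<le> card ({i. i < n \<and> x i \<noteq> y i} \<union> {i. i < n \<and> y i \<noteq> z i})"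
    unfolding hamming_def by (intro card_mono) auto
  also have "\<dots> \<le> hamming n x y + hamming n y z"
    unfolding hamming_def by (rule card_Un_le)
  finally show ?thesis .
qed

lemma hamming_switch_at_le: "hamming n (switch_at N x y) z \<le> hamming N x z + hamming n y z"
proof -
  have "hamming n (switch_at N x y) z \<le> card ({i. i < N \<and> x i \<noteq> z i} \<union> {i. i < n \<and> y i \<noteq> z i})"
    unfolding hamming_def switch_at_def by (intro card_mono) (auto split: if_splits)
  also have "\<dots> \<le> hamming N x z + hamming n y z"
    unfolding hamming_def by (rule card_Un_le)
  finally show ?thesis .
qed

text \<open>With \<open>dbar_leI\<close>, this trades the limsup for eventual linear bounds on
  \<open>hamming\<close>, the form in which the estimates below are made.\<close>

lemma dbar_eventually:
  assumes "dbar x y < e"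
  shows "\<forall>\<^sub>F n in sequentially. real (hamming n x y) \<le> e * real n"
proof -
  have "limsup (\<lambda>n. ereal (real (hamming n x y) / real n)) < ereal e"
    using assms by (simp add: hamming_def flip: ereal_dbar)
  then have "\<forall>\<^sub>F n in sequentially. ereal (real (hamming n x y) / real n) < ereal e"
    by (rule Limsup_lessD)
  then show ?thesis
    using eventually_gt_at_top[of 0]
    by eventually_elim (simp add: field_simps)
qed

lemma dbar_leI:
  assumes "\<forall>\<^sub>F n in sequentially. real (hamming n x y) \<le> e * real n"
  shows "dbar x y \<le> e"
proof -
  have "\<forall>\<^sub>F n in sequentially. ereal (real (hamming n x y) / real n) \<le> ereal e"
    using assms eventually_gt_at_top[of 0]
    by eventually_elim (simp add: field_simps)
  then have "limsup (\<lambda>n. ereal (real (hamming n x y) / real n)) \<le> ereal e"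
    by (rule Limsup_bounded)
  then show ?thesis by (simp add: hamming_def flip: ereal_dbar)
qed

lemma dbar_nonneg: "0 \<le> dbar x y"
proof -
  have "0 \<le> limsup (\<lambda>n. ereal (real (hamming n x y) / real n))"
    by (intro le_Limsup always_eventually) auto
  then show ?thesis by (simp add: hamming_def flip: ereal_dbar)
qed

text \<open>The limit argument, free of words: \<open>step\<close> combines a switch at any late
  \<open>N\<close> with the passage to the next level. Its bound holds for every \<open>n\<close>,
  so the errors can be summed both for pointwise convergence and for \<open>dbar\<close>.\<close>

lemma switching_limit:
  fixes Y :: "nat \<Rightarrow> (nat \<Rightarrow> bit) set" and z :: "nat \<Rightarrow> nat \<Rightarrow> bit"
  assumes cauchy: "dbar_Cauchy z"
    and closed: "\<And>m y. (\<And>n. \<exists>x\<in>Y m. \<forall>i<n. x i = y i) \<Longrightarrow> y \<in> Y m"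
    and decr: "\<And>m. Y (Suc m) \<subseteq> Y m"
    and nonempty: "Y 0 \<noteq> {}"
    and step: "\<And>m u. u \<in> Y m \<Longrightarrow> \<exists>N0. \<forall>N\<ge>N0. \<exists>u'\<in>Y (Suc m). \<forall>n.
        real (hamming n u' (switch_at N u (z (Suc m)))) \<le> (1/2) ^ m * real n"
  obtains y where "\<And>m. y \<in> Y m" "(\<lambda>m. dbar (z m) y) \<longlonglongrightarrow> 0"
proof -
  define d where "d m p = dbar (z m) (z p)" for m p
  define nxtrel where "nxtrel m u N u' \<longleftrightarrow> u' \<in> Y (Suc m) \<and>
    (\<forall>n. real (hamming n u' (switch_at N u (z (Suc m)))) \<le> (1/2) ^ m * real n)" for m u N u'
  \<comment> \<open>\<open>N\<close> is so late that the eventual bounds behind \<open>dbar\<close>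
    hold from \<open>N\<close> on. Only \<open>p \<le> m\<close> is asked, which makes finitely many
    bounds; those for \<open>z m\<close> and \<open>z (Suc m)\<close> serve before and after the
    switch.\<close>
  define good where "good m N u \<longleftrightarrow>
     (\<forall>n\<ge>N. real (hamming n u (z m)) \<le> 4 * (1/2) ^ m * real n) \<and>
     (\<forall>p\<le>m. \<forall>n\<ge>N. real (hamming n (z m) (z p)) \<le> (d m p + (1/2) ^ m) * real n) \<and>
     (\<forall>p\<le>m. \<forall>n\<ge>N. real (hamming n (z (Suc m)) (z p)) \<le> (d (Suc m) p + (1/2) ^ m) * real n)" for m N u
  \<comment> \<open>The state carries the position \<open>N\<close> of the next switch; the
    existence of a successor is part of it, so that \<open>N\<close> is late enough for
    \<open>step\<close> too.\<close>
  define P where "P m = (\<lambda>(u, N). u \<in> Y m \<and> m < N \<and> good m N u \<and> (\<exists>u'. nxtrel m u N u'))" for m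
  define Q where "Q m = (\<lambda>(u, N) (u', N'). N \<le> N' \<and> nxtrel m u N u')" for m and N N' :: nat
  have extend: "\<exists>N. P m (u, N) \<and> K \<le> N"
    if u: "u \<in> Y m" and ev: "\<forall>\<^sub>F n in sequentially. real (hamming n u (z m)) \<le> 4 * (1/2) ^ m * real n"
    for m u K
  proof -
    have z_ev: "\<forall>\<^sub>F n in sequentially. \<forall>p\<in>{..m}. real (hamming n (z k) (z p)) \<le> (d k p + (1/2) ^ m) * real n" for k
      by (intro eventually_ball_finite ballI dbar_eventually) (auto simp: d_def)
    obtain N0 where N0: "\<forall>N\<ge>N0. \<exists>u'. nxtrel m u N u'"
      using step[OF u] unfolding nxtrel_def by blast
    obtain N1 where N1: "\<And>n. N1 \<le> n \<Longrightarrow> real (hamming n u (z m)) \<le> 4 * (1/2) ^ m * real n"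
      using ev unfolding eventually_sequentially by blast
    obtain N2 where N2: "\<And>n p. N2 \<le> n \<Longrightarrow> p \<le> m \<Longrightarrow> real (hamming n (z m) (z p)) \<le> (d m p + (1/2) ^ m) * real n"
      using z_ev[of m] unfolding eventually_sequentially by auto
    obtain N3 where N3: "\<And>n p. N3 \<le> n \<Longrightarrow> p \<le> m \<Longrightarrow> real (hamming n (z (Suc m)) (z p)) \<le> (d (Suc m) p + (1/2) ^ m) * real n"
      using z_ev[of "Suc m"] unfolding eventually_sequentially by auto
    define N where "N = Max {N0, N1, N2, N3, Suc m, K}"
    have N: "N0 \<le> N" "N1 \<le> N" "N2 \<le> N" "N3 \<le> N" "Suc m \<le> N" "K \<le> N"
      by (simp_all add: N_def)
    have "good m N u"
      unfolding good_def
      by (intro conjI allI impI N1 N2 N3 order_trans[OF N(2)] order_trans[OF N(3)] order_trans[OF N(4)])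
    then show ?thesis using u N N0 unfolding P_def by (intro exI[of _ N]) auto
  qed
  have "\<exists>f. \<forall>m. P m (f m) \<and> Q m (f m) (f (Suc m))"
  proof (rule dependent_nat_choice)
    from nonempty obtain u where u: "u \<in> Y 0" by blast
    have "real (hamming n u (z 0)) \<le> 4 * (1/2) ^ 0 * real n" for n
      using hamming_le[of n u "z 0"] by simp
    then have "\<forall>\<^sub>F n in sequentially. real (hamming n u (z 0)) \<le> 4 * (1/2) ^ 0 * real n"
      by (intro always_eventually allI)
    from extend[OF u this] show "\<exists>f. P 0 f" by blast
  next
    fix f m assume "P m f"
    then obtain u N u' where f: "f = (u, N)" "nxtrel m u N u'"
      unfolding P_def by (cases f) auto
    \<comment> \<open>Origin of the factor 4: everything before the switch may be wrong, but
      \<open>N \<le> (1/2) ^ m * n\<close>; with the error of \<open>step\<close> this makes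
      \<open>2 * (1/2) ^ m = 4 * (1/2) ^ Suc m\<close>.\<close>
    have "real (hamming n u' (z (Suc m))) \<le> 4 * (1/2) ^ Suc m * real n" if n: "N * 2 ^ m \<le> n" for n
    proof -
      have "hamming n u' (z (Suc m)) \<le> hamming n u' (switch_at N u (z (Suc m)))
          + (hamming N u (z (Suc m)) + hamming n (z (Suc m)) (z (Suc m)))"
        using hamming_triangle hamming_switch_at_le by (meson add_left_mono le_trans)
      also have "hamming n (z (Suc m)) (z (Suc m)) = 0" by (simp add: hamming_eq_0)
      finally have "real (hamming n u' (z (Suc m))) \<le> (1/2) ^ m * real n + real N"
        using f(2)[unfolded nxtrel_def] hamming_le[of N u "z (Suc m)"]
        by (smt (verit) of_nat_add of_nat_mono add_0_right)
      also have "real N = (1/2) ^ m * real (N * 2 ^ m)" by (simp add: power_one_over)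
      also have "(1/2) ^ m * real (N * 2 ^ m) \<le> (1/2) ^ m * real n"
        using n by (intro mult_left_mono of_nat_mono) auto
      finally show ?thesis by (simp add: mult_ac)
    qed
    then have "\<forall>\<^sub>F n in sequentially. real (hamming n u' (z (Suc m))) \<le> 4 * (1/2) ^ Suc m * real n"
      unfolding eventually_sequentially by blast
    from extend[OF _ this, of N] f(2) obtain N' where "P (Suc m) (u', N')" "N \<le> N'"
      unfolding nxtrel_def by blast
    with f show "\<exists>f'. P (Suc m) f' \<and> Q m f f'"
      by (intro exI[of _ "(u', N')"]) (auto simp: Q_def)
  qed
  then obtain f where f: "\<And>m. P m (f m)" "\<And>m. Q m (f m) (f (Suc m))" by blast
  define u where "u m = fst (f m)" for m
  define N where "N m = snd (f m)" for m
  have f_eq: "f m = (u m, N m)" for m by (simp add: u_def N_def)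
  have uY: "u m \<in> Y m" and N_gt: "m < N m" and good: "good m (N m) (u m)" for m
    using f(1)[of m] by (auto simp: P_def f_eq)
  have N_Suc: "N m \<le> N (Suc m)"
    and nxt: "\<And>n. real (hamming n (u (Suc m)) (switch_at (N m) (u m) (z (Suc m)))) \<le> (1/2) ^ m * real n" for m
    using f(2)[of m] by (auto simp: Q_def f_eq nxtrel_def)
  have N_mono: "N m \<le> N m'" if "m \<le> m'" for m m'
    using that N_Suc by (rule lift_Suc_mono_le[rotated])
  have u_Suc: "real (hamming n (u (Suc m)) (u m)) \<le> (1/2) ^ m * real n" if "n \<le> N m" for n m
  proof -
    have "hamming n (u (Suc m)) (switch_at (N m) (u m) (z (Suc m))) = hamming n (u (Suc m)) (u m)"
      using that by (intro hamming_cong) (auto simp: switch_at_def)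
    with nxt[of n m] show ?thesis by simp
  qed
  define y where "y i = u (Suc i) i" for i
  \<comment> \<open>Among the first \<open>Suc i \<le> m\<close> symbols, \<open>u m\<close> and
    \<open>u (Suc m)\<close> have at most \<open>m / 2 ^ m < 1\<close> mismatches, hence none:
    symbol \<open>i\<close> is frozen from stage \<open>Suc i\<close> on.\<close>
  have u_y: "u m i = y i" if "i < m" for m i
    using that
  proof (induction m)
    case (Suc m)
    show ?case
    proof (cases "i = m")
      case False
      with Suc.prems have im: "i < m" by simp
      have "real (hamming (Suc i) (u (Suc m)) (u m)) \<le> (1/2) ^ m * real (Suc i)"
        using im N_gt[of m] by (intro u_Suc) linarith
      also have "\<dots> \<le> (1/2) ^ m * real m" using im by (intro mult_left_mono) auto
      also have "\<dots> < 1"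
        using of_nat_less_two_power[of m, where ?'a = real] by (simp add: field_simps)
      finally have "hamming (Suc i) (u (Suc m)) (u m) = 0" by simp
      then have "u (Suc m) i = u m i" by (simp add: hamming_eq_0)
      with Suc.IH[OF im] show ?thesis by simp
    qed (simp add: y_def)
  qed simp
  have y_mem: "y \<in> Y m" for m
  proof (rule closed)
    fix n
    have "u (m + n) \<in> Y m"
      using uY[of "m + n"] lift_Suc_antimono_le[of Y m "m + n", OF decr] by auto
    then show "\<exists>x\<in>Y m. \<forall>i<n. x i = y i" by (rule bexI[rotated]) (auto intro!: u_y)
  qed
  have y_u: "real (hamming n y (u q)) \<le> 2 * (1/2) ^ q * real n" if n: "n \<le> N q" for n q
  proof -
    \<comment> \<open>As \<open>n \<le> N q \<le> N (q + k)\<close>, no later switch is felt and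
      stage \<open>q + k\<close> costs only \<open>(1/2) ^ (q + k) * n\<close>; the bound is the
      geometric sum.\<close>
    have tel: "real (hamming n (u (q + k)) (u q)) \<le> 2 * ((1/2) ^ q - (1/2) ^ (q + k)) * real n" for k
    proof (induction k)
      case (Suc k)
      have "real (hamming n (u (q + Suc k)) (u q)) \<le>
         real (hamming n (u (Suc (q + k))) (u (q + k))) + real (hamming n (u (q + k)) (u q))"
        using hamming_triangle by (simp flip: of_nat_add)
      also have "\<dots> \<le> (1/2) ^ (q + k) * real n + 2 * ((1/2) ^ q - (1/2) ^ (q + k)) * real n"
        using n N_mono[of q "q + k"] by (intro add_mono u_Suc Suc) linarith
      also have "\<dots> = 2 * ((1/2) ^ q - (1/2) ^ (q + Suc k)) * real n"
        by (simp add: algebra_simps)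
      finally show ?case .
    qed (simp add: hamming_eq_0)
    have "hamming n y (u q) = hamming n (u (q + n)) (u q)"
      by (intro hamming_cong) (auto simp: u_y)
    with tel[of n] have "real (hamming n y (u q)) \<le> 2 * ((1/2) ^ q - (1/2) ^ (q + n)) * real n" by simp
    also have "\<dots> \<le> 2 * (1/2) ^ q * real n" by (intro mult_right_mono) auto
    finally show ?thesis .
  qed
  \<comment> \<open>Between two switches, go from \<open>y\<close> to \<open>u (Suc r)\<close> and
    on to the switched sequence; before \<open>N r\<close> continue via \<open>u r\<close> and
    \<open>z r\<close> to \<open>z p\<close>, after it via \<open>z (Suc r)\<close>. The powers add
    up to \<open>1 + 1 + 4 + 1 + 1 = 8\<close>.\<close>
  have est: "real (hamming n (z p) y) \<le> (8 * (1/2) ^ r + d r p + d (Suc r) p) * real n"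
    if "p \<le> r" "N r \<le> n" "n \<le> N (Suc r)" for n p r
  proof -
    have "hamming n y (z p) \<le> hamming n y (u (Suc r)) +
       (hamming n (u (Suc r)) (switch_at (N r) (u r) (z (Suc r))) +
        ((hamming (N r) (u r) (z r) + hamming (N r) (z r) (z p)) + hamming n (z (Suc r)) (z p)))"
      using hamming_triangle hamming_switch_at_le by (meson add_left_mono add_right_mono le_trans)
    then have "real (hamming n y (z p)) \<le> real (hamming n y (u (Suc r))) +
       (real (hamming n (u (Suc r)) (switch_at (N r) (u r) (z (Suc r)))) +
        ((real (hamming (N r) (u r) (z r)) + real (hamming (N r) (z r) (z p))) + real (hamming n (z (Suc r)) (z p))))"
      by (simp flip: of_nat_add)
    also have "\<dots> \<le> 2 * (1/2) ^ Suc r * real n + ((1/2) ^ r * real n +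
        ((4 * (1/2) ^ r * real (N r) + (d r p + (1/2) ^ r) * real (N r)) + (d (Suc r) p + (1/2) ^ r) * real n))"
      using that good[of r] unfolding good_def by (intro add_mono y_u nxt) auto
    also have "4 * (1/2) ^ r * real (N r) \<le> 4 * (1/2) ^ r * real n"
      using that by (intro mult_left_mono) auto
    also have "(d r p + (1/2) ^ r) * real (N r) \<le> (d r p + (1/2) ^ r) * real n"
      using that dbar_nonneg[of "z r" "z p"] by (intro mult_left_mono) (auto simp: d_def)
    finally show ?thesis by (simp add: hamming_commute algebra_simps)
  qed
  have "(\<lambda>m. dbar (z m) y) \<longlonglongrightarrow> 0"
  proof (rule LIMSEQ_I)
    fix e :: real assume e: "0 < e"
    \<comment> \<open>The thresholds give \<open>8 * e / 32 + e / 8 + e / 8 = e / 2\<close> in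
      \<open>est\<close>.\<close>
    obtain M where M: "\<And>m n. M \<le> m \<Longrightarrow> M \<le> n \<Longrightarrow> d m n < e / 8"
      using cauchy e unfolding dbar_Cauchy_def d_def by (metis divide_pos_pos zero_less_numeral)
    obtain r0 where r0: "(1/2) ^ r0 < e / 32"
      using real_arch_pow_inv[of "e / 32" "1/2"] e by auto
    have "dbar (z p) y \<le> e / 2" if p: "M \<le> p" for p
    proof (rule dbar_leI)
      define r1 where "r1 = max p r0"
      have "real (hamming n (z p) y) \<le> e / 2 * real n" if n: "N r1 \<le> n" for n
      proof -
        \<comment> \<open>As \<open>q < N q\<close>, some switch lies beyond \<open>n\<close>; the
          least such \<open>q\<close> puts \<open>n\<close> between \<open>N r\<close> and
          \<open>N (Suc r)\<close>.\<close>
        have "\<exists>q. n < N q" using N_gt[of n] by blast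
        then obtain q where q: "n < N q" "\<And>q'. q' < q \<Longrightarrow> \<not> n < N q'"
          using exists_least_iff[of "\<lambda>q. n < N q"] by blast
        have "r1 < q" using q(1) n N_mono[of q r1] by (cases "q \<le> r1") auto
        then obtain r where r: "q = Suc r" "r1 \<le> r" by (cases q) auto
        have rr: "p \<le> r" "r0 \<le> r" using r(2) by (auto simp: r1_def)
        have "N r \<le> n" using q(2)[of r] r(1) by simp
        then have "real (hamming n (z p) y) \<le> (8 * (1/2) ^ r + d r p + d (Suc r) p) * real n"
          using q(1) r(1) rr(1) by (intro est) auto
        also have "\<dots> \<le> e / 2 * real n"
        proof (intro mult_right_mono)
          have "(1/2) ^ r \<le> (1/2 :: real) ^ r0" using rr by (intro power_decreasing) auto
          moreover have "d r p < e / 8" "d (Suc r) p < e / 8"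
            using M p rr(1) by simp_all
          ultimately show "8 * (1/2) ^ r + d r p + d (Suc r) p \<le> e / 2"
            using r0 by linarith
        qed simp
        finally show ?thesis .
      qed
      then show "\<forall>\<^sub>F n in sequentially. real (hamming n (z p) y) \<le> e / 2 * real n"
        unfolding eventually_sequentially by blast
    qed
    then show "\<exists>no. \<forall>n\<ge>no. norm (dbar (z n) y - 0) < e"
      using e dbar_nonneg by (intro exI[of _ M]) (fastforce simp: abs_of_nonneg)
  qed
  with y_mem that show thesis by blast
qed

section \<open>Switching and passing to the next level\<close>

text \<open>Follow \<open>u\<close> to a boundary \<open>p \<ge> N\<close>, enter \<open>z\<close>
  at a boundary \<open>q\<close> at least \<open>2 * a\<close> further on, and fill the gap with
  words. All mismatches lie in \<open>{N..<q}\<close>, of length below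
  \<open>2 * a + 2 * b\<close>.\<close>

lemma glue_concats:
  assumes B: "length ` B = {a..b}" "0 < a" "3 * a < 2 * b"
    and u: "u \<in> concats B" and z: "z \<in> concat_shift B"
  obtains v where "v \<in> concats B"
    "\<And>n. n \<le> N \<Longrightarrow> hamming n v (switch_at N u z) = 0"
    "\<And>n. hamming n v (switch_at N u z) \<le> 4 * b"
proof -
  have len: "0 < length w \<and> length w \<le> b" if "w \<in> B" for w
    using B(1,2) that by fastforce
  obtain ws y where ws: "set ws \<subseteq> B" "u = concat ws \<frown> y"
    "N \<le> length (concat ws)" "length (concat ws) < N + b"
    using concats_boundary_list[OF u len] by metis
  define p where "p = length (concat ws)"
  obtain q where q: "p + 2 * a \<le> q" "q < p + 2 * a + b" "suffix q z \<in> concats B"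
    using concat_shift_boundary[OF z len] by metis
  have "2 * a \<le> q - p" "q - p \<le> 2 * a + b" using q by linarith+
  then obtain cs where cs: "set cs \<subseteq> B" "length (concat cs) = q - p"
    using fill_gap[OF B(1,3)] by metis
  define v where "v = concat ws \<frown> (concat cs \<frown> suffix q z)"
  have v_mem: "v \<in> concats B"
    unfolding v_def by (intro concats_appendI ws cs q)
  have v_u: "v i = u i" if "i < N" for i
    using that ws(3) unfolding v_def ws(2) conc_def by simp
  have v_z: "v i = z i" if "q \<le> i" for i
  proof -
    from that obtain j where j: "i = q + j" by (auto simp: le_iff_add)
    have "i = length (concat ws) + (length (concat cs) + j)" using q(1) cs(2) j by (simp add: p_def)
    then show ?thesis using j by (simp add: v_def conc_def)
  qed
  have "hamming n v (switch_at N u z) \<le> 4 * b" for n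
  proof -
    have "hamming n v (switch_at N u z) \<le> card {N..<q}"
      unfolding hamming_def switch_at_def using v_u v_z by (intro card_mono) (auto simp: not_le[symmetric])
    also have "\<dots> \<le> 4 * b" using q(2) ws(4) B(3) by (simp add: p_def)
    finally show ?thesis .
  qed
  moreover have "hamming n v (switch_at N u z) = 0" if "n \<le> N" for n
    using v_u that by (simp add: hamming_eq_0 switch_at_def)
  ultimately show thesis using that v_mem by blast
qed

text \<open>The new sequence is built block by block.  The state \<open>(p, q)\<close> says that the next block
  starts at \<open>p\<close> and that a word of the given sequence starts at \<open>q\<close>; the block fills \<open>{p..<q}\<close>
  with at most three words and then copies the given sequence up to its final \<open>T\<close>.\<close>
lemma concats_next_level:
  fixes T :: "bit list"
  assumes B: "length ` B = {a..b}" "0 < a" "3 * a < 2 * b" and t: "3 \<le> t"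
    and v: "v \<in> concats B"
  obtains u where "u \<in> concats {concat bs @ T | bs. length bs = t \<and> set bs \<subseteq> B}"
    "\<And>n. hamming n u v \<le> (n div (t * a)) * (3 * b + length T)"
proof -
  let ?B' = "{concat bs @ T | bs. length bs = t \<and> set bs \<subseteq> B}"
  have len: "0 < length w \<and> length w \<le> b" if "w \<in> B" for w
    using B(1,2) that by fastforce
  define ok where "ok = (\<lambda>(p, q). (p = q \<or> p + 2 * a \<le> q \<and> q < p + 2 * a + b) \<and> suffix q v \<in> concats B)"
  define R where "R = (\<lambda>w (p, q) (p', q'::nat). w \<in> ?B' \<and> p' = p + length w \<and> q + length T \<le> p' \<and>
     (\<forall>i. q \<le> i \<and> i + length T < p' \<longrightarrow> w ! (i - p) = v i))"
  have "\<exists>st. \<forall>k. (ok (st k) \<and> (k = 0 \<longrightarrow> st k = (0, 0))) \<and> (\<exists>w. R w (st k) (st (Suc k)))"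
  proof (rule dependent_nat_choice)
    show "\<exists>st. ok st \<and> ((0::nat) = 0 \<longrightarrow> st = (0, 0))" using v by (simp add: ok_def)
  next
    fix st k assume "ok st \<and> (k = (0::nat) \<longrightarrow> st = (0, 0))"
    then obtain p q where st: "st = (p, q)"
      and pq: "p = q \<or> p + 2 * a \<le> q \<and> q < p + 2 * a + b" and q: "suffix q v \<in> concats B"
      by (cases st) (auto simp: ok_def simp del: suffix_nth)
    obtain cs where cs: "length cs \<le> 3" "set cs \<subseteq> B" "length (concat cs) = q - p"
    proof (cases "p = q")
      case True
      then show thesis using that[of "[]"] by simp
    next
      case False
      with pq have "2 * a \<le> q - p" "q - p \<le> 2 * a + b" by linarith+
      then show thesis using fill_gap[OF B(1,3)] that by metis
    qed
    \<comment> \<open>The filling words count among the \<open>t\<close> words of the block;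
      \<open>3 \<le> t\<close> leaves room for them.\<close>
    obtain ws v' where ws: "length ws = t - length cs" "set ws \<subseteq> B" "v' \<in> concats B"
        "suffix q v = concat ws \<frown> v'"
      using q by (rule concats_obtain_list)
    define w where "w = concat (cs @ ws) @ T"
    define p' where "p' = p + length w"
    have "p \<le> q" using pq by linarith
    then have p': "p' = q + length (concat ws) + length T" using cs(3) by (simp add: p'_def w_def)
    \<comment> \<open>The boundary is sought in \<open>v\<close> itself, not after \<open>v'\<close>
      is pushed back by \<open>T\<close>: symbols of \<open>v\<close> keep their positions and no
      drift accumulates.\<close>
    obtain q' where q': "p' + 2 * a \<le> q'" "q' < p' + 2 * a + b" "suffix q' v \<in> concats B"
      using concats_boundary[OF v len] by metis
    have "w ! (i - p) = v i" if i: "q \<le> i" "i + length T < p'" for i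
    proof -
      from i(1) obtain j where j: "i = q + j" by (auto simp: le_iff_add)
      have "i - p = length (concat cs) + j" "j < length (concat ws)"
        using i(2) \<open>p \<le> q\<close> cs(3) p' j by simp_all
      then have "w ! (i - p) = concat ws ! (i - q)"
        using j by (simp add: w_def nth_append)
      also have "\<dots> = suffix q v (i - q)"
        unfolding ws(4) using i p' by (intro conc_fst[symmetric]) linarith
      finally show ?thesis using i by simp
    qed
    moreover have "w \<in> ?B'"
      using cs ws t unfolding w_def by (intro CollectI exI[of _ "cs @ ws"]) simp
    ultimately have "R w st (p', q')"
      unfolding R_def st using p' by (simp add: p'_def)
    moreover have "ok (p', q')" using q' by (simp add: ok_def del: suffix_nth)
    ultimately show "\<exists>st'. (ok st' \<and> (Suc k = 0 \<longrightarrow> st' = (0, 0))) \<and> (\<exists>w. R w st st')"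
      by blast
  qed
  then obtain st w where st: "\<And>k. ok (st k)" "st 0 = (0, 0)" "\<And>k. R (w k) (st k) (st (Suc k))"
    by metis
  define p where "p k = fst (st k)" for k
  define q where "q k = snd (st k)" for k
  have st_eq: "st k = (p k, q k)" for k by (simp add: p_def q_def)
  have pq: "p k \<le> q k" "q k \<le> p k + 3 * b" for k
    using st(1)[of k] B(3) by (auto simp: st_eq ok_def)
  have R: "w k \<in> ?B'" "p (Suc k) = p k + length (w k)" "q k + length T \<le> p (Suc k)"
     "\<And>i. q k \<le> i \<Longrightarrow> i + length T < p (Suc k) \<Longrightarrow> w k ! (i - p k) = v i" for k
    using st(3)[of k] by (auto simp: st_eq R_def)
  have p0: "p 0 = 0" "q 0 = 0" using st(2) by (simp_all add: p_def q_def)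
  have len_B': "t * a + length T \<le> length x" if "x \<in> ?B'" for x
  proof -
    from that obtain bs where bs: "x = concat bs @ T" "length bs = t" "set bs \<subseteq> B" by blast
    have "length bs * a \<le> length (concat bs)" using bs(3)
    proof (induction bs)
      case (Cons c bs)
      then have "a \<le> length c" using B(1) by fastforce
      with Cons show ?case by simp
    qed simp
    with bs show ?thesis by simp
  qed
  have ta: "0 < t * a" using t B(2) by simp
  have "w k \<noteq> []" for k using len_B'[OF R(1)[of k]] ta by auto
  then obtain u where u: "infinite_concat w u" using infinite_concat_exists by blast
  have p_sum: "(\<Sum>i<k. length (w i)) = p k" for k
    by (induction k) (simp_all add: p0 R(2))
  have u_nth: "u i = w k ! (i - p k)" if "p k \<le> i" "i < p (Suc k)" for i k
  proof -
    have "i - p k < length (w k)" using that R(2)[of k] by linarith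
    then have "u (p k + (i - p k)) = w k ! (i - p k)"
      using u unfolding infinite_concat_def p_sum by blast
    then show ?thesis using that by simp
  qed
  have p_ge: "k * (t * a) \<le> p k" for k
  proof (induction k)
    case (Suc k)
    then show ?case using R(2)[of k] len_B'[OF R(1)[of k]] by simp
  qed simp
  \<comment> \<open>The start of the final \<open>T\<close> of block \<open>k\<close>. The bound
    below has \<open>Suc k\<close> rather than \<open>k\<close>, so nothing differs before
    \<open>t * a\<close> and the count needs no additive constant.\<close>
  define A where "A k = p (Suc k) - length T" for k
  have A_ge: "Suc k * (t * a) \<le> A k" for k
    using p_ge[of k] R(2)[of k] len_B'[OF R(1)[of k]] by (simp add: A_def)
  \<comment> \<open>The least \<open>k\<close> with \<open>i < q (Suc k)\<close> gives
    \<open>q k \<le> i\<close>, so a mismatch lies in the \<open>T\<close> of block \<open>k\<close>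
    or in the filling that opens the next block.\<close>
  have mismatch: "\<exists>k. A k \<le> i \<and> i < A k + (3 * b + length T)" if "u i \<noteq> v i" for i
  proof -
    have "\<exists>k. i < q (Suc k)"
    proof
      have "Suc i * 1 \<le> Suc i * (t * a)" using ta by (intro mult_le_mono2) linarith
      then show "i < q (Suc i)" using le_trans[OF _ le_trans[OF p_ge pq(1)]] by fastforce
    qed
    then obtain k where k: "i < q (Suc k)" "\<And>k'. k' < k \<Longrightarrow> \<not> i < q (Suc k')"
      using exists_least_iff[of "\<lambda>k. i < q (Suc k)"] by blast
    have qk: "q k \<le> i" using k(2)[of "k - 1"] p0(2) by (cases k) auto
    have "A k \<le> i"
    proof (rule ccontr)
      assume "\<not> A k \<le> i"
      then have i: "i + length T < p (Suc k)" by (simp add: A_def)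
      have "u i = w k ! (i - p k)"
        using qk pq(1)[of k] i by (intro u_nth) linarith+
      then show False using R(4)[OF qk i] that by simp
    qed
    moreover have "i < A k + (3 * b + length T)"
      using k(1) pq(2)[of "Suc k"] by (simp add: A_def)
    ultimately show ?thesis by blast
  qed
  have "hamming n u v \<le> (n div (t * a)) * (3 * b + length T)" for n
  proof -
    have "{i. i < n \<and> u i \<noteq> v i} \<subseteq> (\<Union>k<n div (t * a). {A k..<A k + (3 * b + length T)})"
    proof
      fix i assume "i \<in> {i. i < n \<and> u i \<noteq> v i}"
      then have i: "i < n" "u i \<noteq> v i" by auto
      from mismatch[OF i(2)] obtain k where k: "A k \<le> i" "i < A k + (3 * b + length T)" by blast
      have "Suc k * (t * a) \<le> n" using A_ge[of k] k(1) i(1) by linarith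
      then have "Suc k \<le> n div (t * a)" using ta by (simp only: less_eq_div_iff_mult_less_eq)
      with k show "i \<in> (\<Union>k<n div (t * a). {A k..<A k + (3 * b + length T)})" by auto
    qed
    then have "hamming n u v \<le> card (\<Union>k<n div (t * a). {A k..<A k + (3 * b + length T)})"
      unfolding hamming_def by (intro card_mono) auto
    also have "\<dots> \<le> (\<Sum>k<n div (t * a). card {A k..<A k + (3 * b + length T)})"
      by (rule card_UN_le) simp
    also have "\<dots> = (n div (t * a)) * (3 * b + length T)" by simp
    finally show ?thesis .
  qed
  moreover have "u \<in> concats ?B'" using R(1) u by (rule infinite_concat_in_concats)
  ultimately show thesis using that by blast
qed

section \<open>Word lengths from level to level\<close>

lemma shortest_longest:
  assumes "length ` B = {a..b}" "a \<le> b"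
  shows "shortest B = a" "longest B = b"
  using assms by (simp_all add: shortest_def longest_def Min_eq_iff Max_eq_iff)

lemma lengths_next_level:
  assumes B: "length ` B = {a..b}"
  shows "length ` {concat bs @ T | bs. length bs = t \<and> set bs \<subseteq> B}
    = {t * a + length T..t * b + length T}" (is "length ` ?B' = _")
proof
  show "length ` ?B' \<subseteq> {t * a + length T..t * b + length T}"
  proof
    fix k assume "k \<in> length ` ?B'"
    then obtain bs where bs: "k = length (concat bs) + length T" "length bs = t" "set bs \<subseteq> B"
      by auto
    have "length bs * a \<le> length (concat bs) \<and> length (concat bs) \<le> length bs * b" using bs(3)
    proof (induction bs)
      case (Cons c bs)
      then have "length c \<in> {a..b}" using B by auto
      with Cons show ?case by simp
    qed simp
    with bs show "k \<in> {t * a + length T..t * b + length T}" by simp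
  qed
  show "{t * a + length T..t * b + length T} \<subseteq> length ` ?B'"
  proof
    fix k assume "k \<in> {t * a + length T..t * b + length T}"
    then have k: "t * a \<le> k - length T" "k - length T \<le> t * b" "length T \<le> k" by auto
    obtain bs where "length bs = t" "set bs \<subseteq> B" "length (concat bs) = k - length T"
      using sum_of_lengths[OF B k(1,2)] .
    then show "k \<in> length ` ?B'"
      using k(3) by (intro image_eqI[of _ _ "concat bs @ T"]) auto
  qed
qed

theorem theorem6p14:
  fixes t :: "nat \<Rightarrow> nat"
    and B :: "nat \<Rightarrow> bit list set"
    and \<beta> :: "nat \<Rightarrow> bit list list"
    and \<tau> :: "nat \<Rightarrow> bit list"
    and s l :: "nat \<Rightarrow> nat"
  assumes t_ge_2: "\<And>n. n \<ge> 1 \<Longrightarrow> t n \<ge> 2"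
    and B_1: "B 1 = {[0], [1, 1]}"
    and construction: "block_construction t B \<beta>"
    and \<tau>: "\<And>n. n \<ge> 1 \<Longrightarrow> \<tau> n = concat (\<beta> n)"
    and s: "\<And>n. n \<ge> 1 \<Longrightarrow> s n = shortest (B n)"
    and l: "\<And>n. n \<ge> 1 \<Longrightarrow> l n = longest (B n)"
    and cond1: "\<And>n. n \<ge> 1 \<Longrightarrow>
      real (t n) > real (length (\<tau> n)) / (2 * real (l n) - 3 * real (s n))"
    and cond2: "\<And>n. n \<ge> 1 \<Longrightarrow>
      real (t n) \<ge> real (l n) / (real (l n) - real (s n))"
    and cond3: "\<And>n. n \<ge> 1 \<Longrightarrow>
      real (t n) \<ge> (2 * real (s n) + 2 * real (l n) + 3 * real (length (\<tau> n))) / real (l n)"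
    and cond4: "\<And>n. n \<ge> 1 \<Longrightarrow>
      real (t n) > (3 * real (l n) + real (length (\<tau> n))) / (real (s n) * 2 powi (- int n))"
  shows "dbar_complete (\<Inter>n\<in>{1..}. concat_shift (B n))"
proof -
  have set_\<beta>: "set (\<beta> n) = B n" if "n \<ge> 1" for n
    using construction that unfolding block_construction_def by blast
  have B_Suc: "B (Suc n) = {concat bs @ \<tau> n | bs. length bs = t n \<and> set bs \<subseteq> B n}" if "n \<ge> 1" for n
    using construction \<tau>[OF that] that unfolding block_construction_def by simp
  \<comment> \<open>The invariant that \<open>fill_gap\<close> needs. Condition (1) with its
    denominator cleared is \<open>3 * s (Suc n) < 2 * l (Suc n)\<close>; the invariant at
    \<open>n\<close> makes that denominator positive.\<close>
  have lengths: "length ` B n = {s n..l n} \<and> 0 < s n \<and> 3 * s n < 2 * l n" if "n \<ge> 1" for n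
    using that
  proof (induction n rule: nat_induct_at_least)
    case base
    have "length ` B 1 = {1..2}" unfolding B_1 by auto
    moreover from shortest_longest[OF this] have "s 1 = 1" "l 1 = 2" by (simp_all add: s l)
    ultimately show ?case by simp
  next
    case (Suc n)
    then have n: "length ` B n = {s n..l n}" "0 < s n" "3 * s n < 2 * l n" by auto
    have len: "length ` B (Suc n) = {t n * s n + length (\<tau> n)..t n * l n + length (\<tau> n)}"
      unfolding B_Suc[OF Suc.hyps] by (rule lengths_next_level[OF n(1)])
    have "t n * s n + length (\<tau> n) \<le> t n * l n + length (\<tau> n)" using n by simp
    from shortest_longest[OF len this]
    have sl: "s (Suc n) = t n * s n + length (\<tau> n)" "l (Suc n) = t n * l n + length (\<tau> n)"
      by (simp_all add: s l)
    have "0 < 2 * real (l n) - 3 * real (s n)" using n(3) by linarith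
    then have "real (length (\<tau> n)) < real (t n) * (2 * real (l n) - 3 * real (s n))"
      using cond1[OF Suc.hyps] by (simp add: field_simps)
    then have "real (3 * s (Suc n)) < real (2 * l (Suc n))"
      by (simp add: sl algebra_simps)
    then have "3 * s (Suc n) < 2 * l (Suc n)" by (simp only: of_nat_less_iff)
    moreover have "0 < s (Suc n)" using n(2) t_ge_2[OF Suc.hyps] by (simp add: sl)
    ultimately show ?case using len by (simp add: sl)
  qed
  \<comment> \<open>Condition (4) without fractions: the mismatch allowance of one block against
    \<open>(1/2) ^ n\<close> times its least length apart from \<open>\<tau> n\<close>.\<close>
  have c4: "3 * real (l n) + real (length (\<tau> n)) < (1/2) ^ n * real (t n * s n)" if "n \<ge> 1" for n
  proof -
    have "0 < real (s n) * (1/2) ^ n" using lengths[OF that] by simp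
    moreover have "2 powi (- int n) = (1/2 :: real) ^ n"
      by (simp add: power_int_minus power_one_over field_simps)
    ultimately show ?thesis using cond4[OF that] by (simp add: divide_less_eq mult_ac)
  qed
  have t_ge_3: "3 \<le> t n" if "n \<ge> 1" for n
  proof -
    have "3 * real (s n) \<le> 3 * real (l n) + real (length (\<tau> n))"
      using lengths[OF that] by simp
    also have "\<dots> < (1/2) ^ n * real (t n * s n)" by (rule c4[OF that])
    also have "\<dots> \<le> 1 * real (t n * s n)" by (intro mult_right_mono power_le_one) auto
    finally have "real (3 * s n) < real (t n * s n)" by simp
    then have "3 * s n < t n * s n" by (simp only: of_nat_less_iff)
    then show ?thesis by simp
  qed
  show ?thesis
    unfolding dbar_complete_def
  proof (intro allI impI, elim conjE)
    fix z :: "nat \<Rightarrow> nat \<Rightarrow> bit"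
    assume z: "range z \<subseteq> (\<Inter>n\<in>{1..}. concat_shift (B n))" and cauchy: "dbar_Cauchy z"
    show "\<exists>y\<in>(\<Inter>n\<in>{1..}. concat_shift (B n)). (\<lambda>n. dbar (z n) y) \<longlonglongrightarrow> 0"
    \<comment> \<open>Levels start at 1, hence \<open>Suc m\<close>. Unshifted concatenations are
      closed and nested, and each lies in the corresponding \<open>concat_shift\<close>, so the
      limit is in the intersection.\<close>
    proof (rule switching_limit[OF cauchy, where Y = "\<lambda>m. concats (B (Suc m))"])
      fix m y assume near: "\<And>n. \<exists>x\<in>concats (B (Suc m)). \<forall>i<n. x i = y i"
      have "finite (B (Suc m))" using set_\<beta>[of "Suc m"] by (metis List.finite_set le_add1 plus_1_eq_Suc)
      then show "y \<in> concats (B (Suc m))" using near by (rule concats_closed)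
    next
      fix m
      show "concats (B (Suc (Suc m))) \<subseteq> concats (B (Suc m))"
      proof (rule concats_refine)
        fix b assume "b \<in> B (Suc (Suc m))"
        then obtain bs where bs: "b = concat bs @ \<tau> (Suc m)" "length bs = t (Suc m)" "set bs \<subseteq> B (Suc m)"
          using B_Suc[of "Suc m"] by auto
        \<comment> \<open>As \<open>\<tau> (Suc m)\<close> is itself a concatenation of words of
          \<open>B (Suc m)\<close>, the whole block splits into such words.\<close>
        show "\<exists>bs. bs \<noteq> [] \<and> set bs \<subseteq> B (Suc m) \<and> b = concat bs"
          using bs set_\<beta>[of "Suc m"] \<tau>[of "Suc m"] t_ge_2[of "Suc m"]
          by (intro exI[of _ "bs @ \<beta> (Suc m)"]) auto
      qed
    next
      have "infinite_concat (\<lambda>_. [0]) (\<lambda>_. 0)" by (simp add: infinite_concat_def)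
      then have "(\<lambda>_. 0) \<in> concats (B (Suc 0))"
        by (rule infinite_concat_in_concats[rotated]) (use B_1 in simp)
      then show "concats (B (Suc 0)) \<noteq> {}" by blast
    next
      fix m u assume u: "u \<in> concats (B (Suc m))"
      define n where "n = Suc m"
      have n: "n \<ge> 1" and u: "u \<in> concats (B n)" using u by (simp_all add: n_def)
      have lens: "length ` B n = {s n..l n}" "0 < s n" "3 * s n < 2 * l n" using lengths[OF n] by auto
      have zX: "z n \<in> concat_shift (B n)" using z n by blast
      show "\<exists>N0. \<forall>N\<ge>N0. \<exists>u'\<in>concats (B (Suc (Suc m))). \<forall>k.
          real (hamming k u' (switch_at N u (z (Suc m)))) \<le> (1/2) ^ m * real k"
      \<comment> \<open>Gluing costs nothing up to \<open>N\<close> and at most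
        \<open>4 * l n\<close> in all, which beyond this threshold is at most
        \<open>(1/2) ^ n * k\<close>. The level change costs at most as much again, and
        \<open>n = Suc m\<close> turns the sum into \<open>(1/2) ^ m * k\<close>.\<close>
      proof (intro exI[of _ "4 * l n * 2 ^ n"] allI impI)
        fix N assume N: "4 * l n * 2 ^ n \<le> N"
        obtain v where v: "v \<in> concats (B n)"
          "\<And>k. k \<le> N \<Longrightarrow> hamming k v (switch_at N u (z n)) = 0"
          "\<And>k. hamming k v (switch_at N u (z n)) \<le> 4 * l n"
          using glue_concats[OF lens u zX, of N] by blast
        obtain u' where u': "u' \<in> concats (B (Suc n))"
          "\<And>k. hamming k u' v \<le> (k div (t n * s n)) * (3 * l n + length (\<tau> n))"
          using concats_next_level[OF lens t_ge_3[OF n] v(1), of "\<tau> n"] 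
          unfolding B_Suc[OF n, symmetric] by blast
        have "real (hamming k u' (switch_at N u (z n))) \<le> (1/2) ^ m * real k" for k
        proof -
          have "real (hamming k u' v) \<le> real (k div (t n * s n) * (3 * l n + length (\<tau> n)))"
            by (intro of_nat_mono u'(2))
          also have "\<dots> = real (k div (t n * s n)) * (3 * real (l n) + real (length (\<tau> n)))"
            by (simp only: of_nat_mult of_nat_add of_nat_numeral)
          also have "\<dots> \<le> real (k div (t n * s n)) * ((1/2) ^ n * real (t n * s n))"
            by (intro mult_left_mono less_imp_le[OF c4[OF n]]) simp
          also have "\<dots> = (1/2) ^ n * real (k div (t n * s n) * (t n * s n))"
            by (simp only: of_nat_mult mult_ac)
          also have "\<dots> \<le> (1/2) ^ n * real k"
            by (intro mult_left_mono of_nat_mono div_times_less_eq_dividend) simp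
          finally have A: "real (hamming k u' v) \<le> (1/2) ^ n * real k" .
          have C: "real (hamming k v (switch_at N u (z n))) \<le> (1/2) ^ n * real k"
          proof (cases "k \<le> N")
            case False
            have "real (hamming k v (switch_at N u (z n))) \<le> real (4 * l n)" using v(3) by (rule of_nat_mono)
            also have "\<dots> = (1/2) ^ n * real (4 * l n * 2 ^ n)" by (simp add: power_one_over)
            also have "\<dots> \<le> (1/2) ^ n * real k"
              using False N by (intro mult_left_mono of_nat_mono) auto
            finally show ?thesis .
          qed (simp add: v(2))
          have "real (hamming k u' (switch_at N u (z n)))
              \<le> real (hamming k u' v) + real (hamming k v (switch_at N u (z n)))"
            using hamming_triangle[of k u' "switch_at N u (z n)" v] by linarith
          also have "\<dots> \<le> (1/2) ^ n * real k + (1/2) ^ n * real k" using A C by (rule add_mono)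
          also have "\<dots> = (1/2) ^ m * real k" by (simp add: n_def)
          finally show ?thesis .
        qed
        with u'(1) show "\<exists>u'\<in>concats (B (Suc (Suc m))). \<forall>k.
            real (hamming k u' (switch_at N u (z (Suc m)))) \<le> (1/2) ^ m * real k"
          unfolding n_def by blast
      qed
    next
      fix y assume y: "\<And>m. y \<in> concats (B (Suc m))" and lim: "(\<lambda>m. dbar (z m) y) \<longlonglongrightarrow> 0"
      have "y \<in> concat_shift (B n)" if "n \<ge> 1" for n
        using y[of "n - 1"] that concats_subset_concat_shift[of "B n"] by auto
      then show ?thesis using lim by (intro bexI[of _ y]) auto
    qed
  qed
qed

end
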